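(* Let $G=(V,E)$ be a level-separable network with source node $s$, let $D$ be the eccentricity of $s$ in $G$, and let the nodes be labelled by the 1-bit labelling scheme $\lambda^{LS}$. Then Algorithm $\beta^{LS}$, executed at every node, implements broadcast within $2D$ rounds: every node of $G$ receives the message $\mu$ of $s$, and the execution finishes by round $2D$ (rounds being numbered from $0$).
   Context: Model. A network is a finite connected undirected graph $G=(V,E)$ with a designated source $s\in V$. Execution is in synchronous rounds numbered $0,1,2,\dots$. In each round every node either transmits a message or stays silent. A node $u$ receives a message in round $x$ (at the end of round $x$) iff exactly one neighbour of $u$ transmits in round $x$; if two or more neighbours transmit, a collision occurs and $u$ receives nothing. Broadcast problem: the source $s$ holds a message $\mu$, which must be received by all other nodes in finite bounded time. Levels. $l(u)=d(s,u)$ is the (hop) distance from $s$ to $u$, $D=\max_u d(s,u)$ is the eccentricity of $s$, and $S_i=\{u\in V: l(u)=i\}$. The set of parents of $v$ is $P(v)=\{u: \{u,v\}\in E,\ l(v)-l(u)=1\}$. Level-separable network. $(G,s)$ is level-separable if for every $i\in[1,D-1]$ there is a partition $S_i=S_{i,1}\sqcup S_{i,2}$ (parts may be empty) such that for every $u\in S_{i+1}$: $|P(u)\cap S_{i,1}|=1$ or $|P(u)\cap S_{i,2}|=1$. Labelling $\lambda^{LS}$. Fix such partitions (and any partition $S_D=S_{D,1}\sqcup S_{D,2}$). For every $i>0$, each node of $S_{i,1}$ gets the bit $X_1=1$ and each node of $S_{i,2}$ gets $X_1=0$. Algorithm $\beta^{LS}$. The source transmits $\mu$ in round $0$ and never again.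 A non-source node that receives $\mu$ for the first time in round $r$ transmits $\mu$ exactly once, in the following round: if $r$ is odd, in round $r+2$ when $X_1=1$ and in round $r+3$ when $X_1=0$; if $r$ is even, in round $r+1$ when $X_1=1$ and in round $r+2$ when $X_1=0$. Nodes are silent in all other rounds. The execution is finished by round $2D$ if all nodes have received $\mu$ by then and no node transmits in a round later than $2D$. *)

theory Defs
  imports Main
begin

definition network :: "'v set \<Rightarrow> 'v set set \<Rightarrow> 'v \<Rightarrow> bool" where
  "network V E s \<longleftrightarrow> finite V \<and> s \<in> V \<and> (\<forall>e\<in>E. e \<subseteq> V \<and> card e = 2) \<and>
     (\<forall>u\<in>V. \<forall>v\<in>V. (u, v) \<in> {(x, y). {x, y} \<in> E}\<^sup>*)"

(* The exponent counts the edges of a walk, so this is the hop distance. *)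
definition hop_dist :: "'v set set \<Rightarrow> 'v \<Rightarrow> 'v \<Rightarrow> nat" where
  "hop_dist E u v = (LEAST n. (u, v) \<in> {(x, y). {x, y} \<in> E} ^^ n)"

definition ecc :: "'v set \<Rightarrow> 'v set set \<Rightarrow> 'v \<Rightarrow> nat" where
  "ecc V E s = Max (hop_dist E s ` V)"

definition level :: "'v set \<Rightarrow> 'v set set \<Rightarrow> 'v \<Rightarrow> nat \<Rightarrow> 'v set" where
  "level V E s i = {u \<in> V. hop_dist E s u = i}"

definition parents :: "'v set set \<Rightarrow> 'v \<Rightarrow> 'v \<Rightarrow> 'v set" where
  "parents E s v = {u. {u, v} \<in> E \<and> hop_dist E s v = hop_dist E s u + 1}"

definition splits :: "'a set \<Rightarrow> 'a set \<Rightarrow> 'a set \<Rightarrow> bool" where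
  "splits S A B \<longleftrightarrow> A \<union> B = S \<and> A \<inter> B = {}"

definition separates :: "'v set \<Rightarrow> 'v set set \<Rightarrow> 'v \<Rightarrow> nat \<Rightarrow> 'v set \<Rightarrow> 'v set \<Rightarrow> bool" where
  "separates V E s i A B \<longleftrightarrow> splits (level V E s i) A B \<and>
     (\<forall>u \<in> level V E s (i + 1). card (parents E s u \<inter> A) = 1 \<or> card (parents E s u \<inter> B) = 1)"

definition level_separable :: "'v set \<Rightarrow> 'v set set \<Rightarrow> 'v \<Rightarrow> bool" where
  "level_separable V E s \<longleftrightarrow> (\<forall>i \<in> {1..<ecc V E s}. \<exists>A B. separates V E s i A B)"

(* The last level is split arbitrarily; the bit of the source is unconstrained. *)
definition LS_labelling ::
  "'v set \<Rightarrow> 'v set set \<Rightarrow> 'v \<Rightarrow> (nat \<Rightarrow> 'v set) \<Rightarrow> (nat \<Rightarrow> 'v set) \<Rightarrow> ('v \<Rightarrow> bool) \<Rightarrow> bool" where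
  "LS_labelling V E s S1 S2 X1 \<longleftrightarrow>
     (\<forall>i \<in> {1..<ecc V E s}. separates V E s i (S1 i) (S2 i)) \<and>
     (\<forall>i \<in> {1..ecc V E s}. splits (level V E s i) (S1 i) (S2 i) \<and>
        (\<forall>u \<in> S1 i. X1 u) \<and> (\<forall>u \<in> S2 i. \<not> X1 u))"

(* A node decides what to transmit in round x from its label, the message it holds
   initially (None if there is none) and the list, of length x, of what it received in
   rounds 0, ..., x - 1.  None stands for silence, respectively for receiving nothing. *)
type_synonym ('l, 'm) node_algorithm = "'l \<Rightarrow> 'm option \<Rightarrow> 'm option list \<Rightarrow> 'm option"

definition receive :: "'v set set \<Rightarrow> ('v \<Rightarrow> 'm option) \<Rightarrow> 'v \<Rightarrow> 'm option" where
  "receive E t u =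
     (if \<exists>!v. {u, v} \<in> E \<and> t v \<noteq> None then t (THE v. {u, v} \<in> E \<and> t v \<noteq> None) else None)"

definition initial :: "'v \<Rightarrow> 'm \<Rightarrow> 'v \<Rightarrow> 'm option" where
  "initial s \<mu> u = (if u = s then Some \<mu> else None)"

primrec history ::
  "'v set set \<Rightarrow> 'v \<Rightarrow> ('l, 'm) node_algorithm \<Rightarrow> ('v \<Rightarrow> 'l) \<Rightarrow> 'm \<Rightarrow> nat \<Rightarrow> 'v \<Rightarrow> 'm option list" where
  "history E s \<A> lab \<mu> 0 = (\<lambda>u. [])"
| "history E s \<A> lab \<mu> (Suc x) = (\<lambda>u. history E s \<A> lab \<mu> x u @
     [receive E (\<lambda>v. \<A> (lab v) (initial s \<mu> v) (history E s \<A> lab \<mu> x v)) u])"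

definition transmitted ::
  "'v set set \<Rightarrow> 'v \<Rightarrow> ('l, 'm) node_algorithm \<Rightarrow> ('v \<Rightarrow> 'l) \<Rightarrow> 'm \<Rightarrow> nat \<Rightarrow> 'v \<Rightarrow> 'm option" where
  "transmitted E s \<A> lab \<mu> x u = \<A> (lab u) (initial s \<mu> u) (history E s \<A> lab \<mu> x u)"

definition received ::
  "'v set set \<Rightarrow> 'v \<Rightarrow> ('l, 'm) node_algorithm \<Rightarrow> ('v \<Rightarrow> 'l) \<Rightarrow> 'm \<Rightarrow> nat \<Rightarrow> 'v \<Rightarrow> 'm option" where
  "received E s \<A> lab \<mu> x u = receive E (transmitted E s \<A> lab \<mu> x) u"

definition LS_round :: "bool \<Rightarrow> nat \<Rightarrow> nat" where
  "LS_round X1 r = (if odd r then (if X1 then r + 2 else r + 3)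
                    else (if X1 then r + 1 else r + 2))"

(* For a non-source node, r is the round of its first reception (if r < length h).  The
   node does not know the source message in advance: it forwards what it received first.
   As no other message is ever sent, this is the first reception of the source message. *)
definition beta_LS :: "(bool, 'm) node_algorithm" where
  "beta_LS X1 m h = (case m of
       Some \<mu> \<Rightarrow> if length h = 0 then Some \<mu> else None
     | None \<Rightarrow> let r = length (takeWhile (\<lambda>y. y = None) h) in
         if r < length h \<and> length h = LS_round X1 r then h ! r else None)"

definition broadcast_by ::
  "'v set \<Rightarrow> 'v set set \<Rightarrow> 'v \<Rightarrow> ('l, 'm) node_algorithm \<Rightarrow> ('v \<Rightarrow> 'l) \<Rightarrow> 'm \<Rightarrow> nat \<Rightarrow> bool" where
  "broadcast_by V E s \<A> lab \<mu> N \<longleftrightarrow>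
     (\<forall>u \<in> V - {s}. \<exists>x \<le> N. received E s \<A> lab \<mu> x u = Some \<mu>) \<and>
     (\<forall>u \<in> V. \<forall>x > N. transmitted E s \<A> lab \<mu> x u = None)"

end

theory Submission
  imports Defs
begin

text \<open>A node of level \<open>i > 0\<close> transmits exactly once, in round \<open>2 i - 1\<close> or \<open>2 i\<close> according to its
  bit, so no two levels ever transmit in the same round. Hence a node of level \<open>i + 1\<close>
  hears nothing before round \<open>2 i - 1\<close>, and in rounds \<open>2 i - 1\<close> and \<open>2 i\<close> precisely its parents
  in the two parts of level \<open>i\<close> transmit; one of these sets is a singleton, so the
  node first receives in one of the two rounds. The parity of that round tells the node which of
  the two it was, and this is how the rule of the algorithm restores the schedule.\<close>

lemma hop_dist_relpow:
  assumes "(s, v) \<in> {(x, y). {x, y} \<in> E}\<^sup>*"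
  shows "(s, v) \<in> {(x, y). {x, y} \<in> E} ^^ hop_dist E s v"
proof -
  obtain n where "(s, v) \<in> {(x, y). {x, y} \<in> E} ^^ n"
    using rtrancl_imp_relpow[OF assms] by blast
  then show ?thesis unfolding hop_dist_def by (rule LeastI)
qed

lemma hop_dist_le: "(s, v) \<in> {(x, y). {x, y} \<in> E} ^^ n \<Longrightarrow> hop_dist E s v \<le> n"
  unfolding hop_dist_def by (rule Least_le)

lemma hop_dist_self [simp]: "hop_dist E s s = 0"
  using hop_dist_le[of s s 0 E] by simp

text \<open>Agreement is asked of neighbours only, because the run is compared with the schedule
  only on \<open>V\<close>, where all endpoints of edges lie.\<close>

lemma receive_cong:
  assumes "\<And>v. {u, v} \<in> E \<Longrightarrow> t v = t' v"
  shows "receive E t u = receive E t' u"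
proof -
  have "({u, v} \<in> E \<and> t v \<noteq> None) = ({u, v} \<in> E \<and> t' v \<noteq> None)" for v
    using assms by auto
  moreover have "t (THE v. {u, v} \<in> E \<and> t' v \<noteq> None) = t' (THE v. {u, v} \<in> E \<and> t' v \<noteq> None)"
    if "\<exists>!v. {u, v} \<in> E \<and> t' v \<noteq> None"
    using theI'[OF that] assms by blast
  ultimately show ?thesis
    unfolding receive_def by simp
qed

lemma receive_unique:
  assumes "\<exists>!v. {u, v} \<in> E \<and> t v \<noteq> None" "\<And>v. t v \<noteq> None \<Longrightarrow> t v = Some \<mu>"
  shows "receive E t u = Some \<mu>"
  using theI'[OF assms(1)] assms unfolding receive_def by auto

lemma history_eq_map:
  "history E s \<A> lab \<mu> x u = map (\<lambda>y. received E s \<A> lab \<mu> y u) [0..<x]"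
  by (induction x) (auto simp: received_def transmitted_def[abs_def])

text \<open>Evaluates the \<open>r\<close> that \<open>beta_LS\<close> computes from a history. The
  minimum covers a history that ends before the first reception.\<close>

lemma length_takeWhile_map_upt:
  assumes "\<And>y. y < r \<Longrightarrow> P (f y)" "\<not> P (f r)"
  shows "length (takeWhile P (map f [0..<x])) = min r x"
proof (cases "r < x")
  case True
  have "takeWhile P (map f [0..<x]) = take r (map f [0..<x])"
    using assms True by (intro takeWhile_eq_take_P_nth) auto
  then show ?thesis using True by simp
next
  case False
  then have all: "takeWhile P (map f [0..<x]) = map f [0..<x]"
    using assms by (auto simp: takeWhile_eq_all_conv)
  show ?thesis unfolding all using False by simp
qed

text \<open>The intended transmission round, in closed form: it refers only to level and bit, so
  receptions can be analysed without histories.\<close>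

definition sched :: "'v set set \<Rightarrow> 'v \<Rightarrow> ('v \<Rightarrow> bool) \<Rightarrow> 'v \<Rightarrow> nat" where
  "sched E s X1 v = (if v = s then 0 else if X1 v then 2 * hop_dist E s v - 1 else 2 * hop_dist E s v)"

definition sched_tx ::
  "'v set set \<Rightarrow> 'v \<Rightarrow> ('v \<Rightarrow> bool) \<Rightarrow> 'm \<Rightarrow> nat \<Rightarrow> 'v \<Rightarrow> 'm option" where
  "sched_tx E s X1 \<mu> x v = (if x = sched E s X1 v then Some \<mu> else None)"

lemma sched_tx_neq_None: "sched_tx E s X1 \<mu> x v \<noteq> None \<longleftrightarrow> sched E s X1 v = x"
  by (simp add: sched_tx_def eq_commute)

lemma sched_tx_Some: "sched_tx E s X1 \<mu> x v \<noteq> None \<Longrightarrow> sched_tx E s X1 \<mu> x v = Some \<mu>"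
  by (simp add: sched_tx_def split: if_splits)

lemma receive_sched_tx_Some:
  assumes "receive E (sched_tx E s X1 \<mu> x) u \<noteq> None"
  shows "receive E (sched_tx E s X1 \<mu> x) u = Some \<mu>"
proof (rule receive_unique)
  show "\<exists>!v. {u, v} \<in> E \<and> sched_tx E s X1 \<mu> x v \<noteq> None"
    using assms unfolding receive_def by (rule contrapos_np) (rule if_not_P)
qed (rule sched_tx_Some)

context
  fixes V :: "'v set" and E :: "'v set set" and s :: 'v
  assumes net: "network V E s"
begin

lemma edge_in_V: "{u, v} \<in> E \<Longrightarrow> v \<in> V"
  using net unfolding network_def by blast

lemma reachable: "v \<in> V \<Longrightarrow> (s, v) \<in> {(x, y). {x, y} \<in> E}\<^sup>*"
  using net unfolding network_def by blast

lemma hop_dist_eq_0: "v \<in> V \<Longrightarrow> hop_dist E s v = 0 \<longleftrightarrow> v = s"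
  using hop_dist_relpow[OF reachable, of v] by auto

lemma hop_dist_edge:
  assumes "{u, v} \<in> E"
  shows "hop_dist E s u \<le> Suc (hop_dist E s v)"
proof -
  have "(s, v) \<in> {(x, y). {x, y} \<in> E} ^^ hop_dist E s v"
    by (rule hop_dist_relpow[OF reachable[OF edge_in_V[OF assms]]])
  moreover have "(v, u) \<in> {(x, y). {x, y} \<in> E}"
    using assms by (simp add: insert_commute)
  ultimately have "(s, u) \<in> {(x, y). {x, y} \<in> E} ^^ Suc (hop_dist E s v)"
    by auto
  then show ?thesis by (rule hop_dist_le)
qed

lemma hop_dist_le_ecc: "v \<in> V \<Longrightarrow> hop_dist E s v \<le> ecc V E s"
  using net unfolding network_def ecc_def by simp

lemma sched_bounds:
  assumes "v \<in> V"
  shows "sched E s X1 v \<le> 2 * hop_dist E s v" "2 * hop_dist E s v \<le> Suc (sched E s X1 v)"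
  using hop_dist_eq_0[OF assms] by (auto simp: sched_def)

text \<open>With \<open>l\<close> the level of \<open>u\<close>, every neighbour has level at least
  \<open>l - 1\<close> and so transmits no earlier than round
  \<open>2 * (l - 1) - 1\<close>.\<close>

lemma sched_no_early_reception:
  assumes "y < 2 * hop_dist E s u - 3"
  shows "receive E (sched_tx E s X1 \<mu> y) u = None"
proof -
  have "sched E s X1 v \<noteq> y" if "{u, v} \<in> E" for v
    using sched_bounds(2)[OF edge_in_V[OF that], of X1] hop_dist_edge[OF that] assms by linarith
  then show ?thesis
    unfolding receive_def sched_tx_neq_None by auto
qed

context
  fixes S1 S2 :: "nat \<Rightarrow> 'v set" and X1 :: "'v \<Rightarrow> bool"
  assumes lab: "LS_labelling V E s S1 S2 X1"
begin

text \<open>The two rounds belong to level \<open>Suc j\<close> alone, so a neighbour transmitting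
  in one of them is a parent, and its bit tells its part.\<close>

lemma parents_in_part:
  assumes "u \<in> V" and lu: "hop_dist E s u = Suc (Suc j)"
  shows "parents E s u \<inter> S1 (Suc j) = {v. {u, v} \<in> E \<and> sched E s X1 v = 2 * Suc j - 1}"
    and "parents E s u \<inter> S2 (Suc j) = {v. {u, v} \<in> E \<and> sched E s X1 v = 2 * Suc j}"
proof -
  have "Suc j \<in> {1..ecc V E s}"
    using hop_dist_le_ecc[OF \<open>u \<in> V\<close>] lu by simp
  then have sp: "S1 (Suc j) \<union> S2 (Suc j) = level V E s (Suc j)"
    and bit: "\<And>v. v \<in> S1 (Suc j) \<Longrightarrow> X1 v" "\<And>v. v \<in> S2 (Suc j) \<Longrightarrow> \<not> X1 v"
    using lab unfolding LS_labelling_def splits_def by blast+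
  have part: "v \<in> S1 (Suc j) \<longleftrightarrow> X1 v" "v \<in> S2 (Suc j) \<longleftrightarrow> \<not> X1 v"
    if "v \<in> level V E s (Suc j)" for v
    using sp bit that by blast+
  have par: "parents E s u = {v. {u, v} \<in> E \<and> v \<in> level V E s (Suc j)}"
    using edge_in_V lu by (auto simp: parents_def level_def insert_commute)
  \<comment> \<open>The round is positive, which excludes the source; its parity then gives the bit,
    and its value the level.\<close>
  have lvl: "sched E s X1 v = 2 * Suc j - 1 \<longleftrightarrow> v \<in> level V E s (Suc j) \<and> X1 v"
    "sched E s X1 v = 2 * Suc j \<longleftrightarrow> v \<in> level V E s (Suc j) \<and> \<not> X1 v" if "v \<in> V" for v
    using that hop_dist_eq_0[OF that] unfolding sched_def level_def
    by (cases "X1 v"; auto; presburger)+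
  show "parents E s u \<inter> S1 (Suc j) = {v. {u, v} \<in> E \<and> sched E s X1 v = 2 * Suc j - 1}"
    unfolding par using edge_in_V lvl(1) part(1) by blast
  show "parents E s u \<inter> S2 (Suc j) = {v. {u, v} \<in> E \<and> sched E s X1 v = 2 * Suc j}"
    unfolding par using edge_in_V lvl(2) part(2) by blast
qed

text \<open>For level 1, truncated subtraction makes both bounds on the round equal to 0.\<close>

lemma sched_reception:
  assumes "u \<in> V" "u \<noteq> s"
  shows "\<exists>y. 2 * hop_dist E s u - 3 \<le> y \<and> y \<le> 2 * hop_dist E s u - 2 \<and>
    receive E (sched_tx E s X1 \<mu> y) u = Some \<mu>"
proof -
  have "\<exists>y. 2 * hop_dist E s u - 3 \<le> y \<and> y \<le> 2 * hop_dist E s u - 2 \<and>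
    (\<exists>!v. {u, v} \<in> E \<and> sched E s X1 v = y)"
  \<comment> \<open>Level 0 is not partitioned, so level 1 is treated apart: in round 0 the source
    is the only transmitter.\<close>
  proof (cases "hop_dist E s u = 1")
    case True
    then have "{u, s} \<in> E"
      using hop_dist_relpow[OF reachable[OF \<open>u \<in> V\<close>]] by (simp add: insert_commute)
    moreover have "v = s" if "{u, v} \<in> E" "sched E s X1 v = 0" for v
      using sched_bounds(2)[OF edge_in_V[OF that(1)], of X1] that
        hop_dist_eq_0[OF edge_in_V[OF that(1)]] by simp
    ultimately have "\<exists>!v. {u, v} \<in> E \<and> sched E s X1 v = 0"
      by (intro ex1I[of _ s]) (auto simp: sched_def)
    with True show ?thesis by (intro exI[of _ 0]) simp
  next
    case False
    then obtain j where j: "hop_dist E s u = Suc (Suc j)"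
      using hop_dist_eq_0[OF \<open>u \<in> V\<close>] \<open>u \<noteq> s\<close> by (metis One_nat_def not0_implies_Suc)
    \<comment> \<open>Since \<open>u\<close> lies one level further out, \<open>Suc j\<close> is
      below the eccentricity, where separation is guaranteed.\<close>
    have "separates V E s (Suc j) (S1 (Suc j)) (S2 (Suc j))"
      using lab j hop_dist_le_ecc[OF \<open>u \<in> V\<close>] unfolding LS_labelling_def by simp
    then have "card (parents E s u \<inter> S1 (Suc j)) = 1 \<or> card (parents E s u \<inter> S2 (Suc j)) = 1"
      using j \<open>u \<in> V\<close> unfolding separates_def level_def by simp
    then obtain y where "y = 2 * Suc j - 1 \<or> y = 2 * Suc j"
      and card: "card {v. {u, v} \<in> E \<and> sched E s X1 v = y} = 1"
      unfolding parents_in_part[OF \<open>u \<in> V\<close> j] by blast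
    moreover have "\<exists>!v. {u, v} \<in> E \<and> sched E s X1 v = y"
      using card unfolding card_1_singleton_iff One_nat_def set_eq_iff by (simp add: Ex1_def) metis
    ultimately show ?thesis
      using j by (intro exI[of _ y]) auto
  qed
  then obtain y where y: "2 * hop_dist E s u - 3 \<le> y" "y \<le> 2 * hop_dist E s u - 2"
    and "\<exists>!v. {u, v} \<in> E \<and> sched E s X1 v = y"
    by blast
  then have "receive E (sched_tx E s X1 \<mu> y) u = Some \<mu>"
    by (intro receive_unique sched_tx_Some) (simp_all only: sched_tx_neq_None)
  with y show ?thesis by blast
qed

text \<open>If \<open>i\<close> is the level below \<open>u\<close>, the first reception is in round
  \<open>2 * i - 1\<close> or \<open>2 * i\<close>. The extra round of delay after an odd reception
  makes both cases lead to \<open>2 * i + 1\<close> or \<open>2 * i + 2\<close>, according to the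
  bit of \<open>u\<close>.\<close>

lemma sched_first_reception:
  assumes "u \<in> V" "u \<noteq> s"
  obtains r where "receive E (sched_tx E s X1 \<mu> r) u = Some \<mu>"
    and "\<And>y. y < r \<Longrightarrow> receive E (sched_tx E s X1 \<mu> y) u = None"
    and "LS_round (X1 u) r = sched E s X1 u"
proof -
  let ?rcv = "\<lambda>y. receive E (sched_tx E s X1 \<mu> y) u"
  obtain i where i: "hop_dist E s u = Suc i"
    using hop_dist_eq_0 assms not0_implies_Suc by metis
  obtain y where y: "2 * Suc i - 3 \<le> y" "y \<le> 2 * Suc i - 2" "?rcv y = Some \<mu>"
    using sched_reception[OF assms] i by metis
  have early: "?rcv z = None" if "z < 2 * Suc i - 3" for z
    using sched_no_early_reception that i by metis
  \<comment> \<open>The round \<open>y\<close> need not be the first: both parts may contain exactly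
    one parent of \<open>u\<close>.\<close>
  define r where "r = (LEAST y. ?rcv y \<noteq> None)"
  have "?rcv y \<noteq> None" using y(3) by simp
  note ry = Least_le[of "\<lambda>y. ?rcv y \<noteq> None", OF this, folded r_def]
    and r = LeastI[of "\<lambda>y. ?rcv y \<noteq> None", OF this, folded r_def]
  have before: "?rcv z = None" if "z < r" for z
    using not_less_Least[of z "\<lambda>y. ?rcv y \<noteq> None"] that unfolding r_def by simp
  have ge: "2 * Suc i - 3 \<le> r"
    using early[of r] r by (meson not_le)
  have rcv: "?rcv r = Some \<mu>"
    by (rule receive_sched_tx_Some[OF r])
  have "r \<le> 2 * Suc i - 2" using ry y(2) by linarith
  \<comment> \<open>The odd round \<open>2 * i - 1\<close> exists only for \<open>i > 0\<close>; for
    \<open>i = 0\<close> both bounds on \<open>r\<close> are 0.\<close>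
  with ge consider "r = 2 * i" | k where "i = Suc k" "r = Suc (2 * k)"
    by (cases i) (simp_all, linarith)
  then have round: "LS_round (X1 u) r = sched E s X1 u"
    using i \<open>u \<noteq> s\<close> unfolding LS_round_def sched_def by cases simp_all
  show thesis by (rule that[OF rcv before round])
qed

text \<open>Strong induction on the round: the history before round \<open>x\<close> depends only on
  earlier transmissions of neighbours, which follow the schedule by the induction
  hypothesis.\<close>

lemma beta_LS_follows_sched:
  "u \<in> V \<Longrightarrow> transmitted E s beta_LS X1 \<mu> x u = sched_tx E s X1 \<mu> x u"
proof (induction x arbitrary: u rule: less_induct)
  case (less x)
  let ?rcv = "\<lambda>y. receive E (sched_tx E s X1 \<mu> y) u"
  have "received E s beta_LS X1 \<mu> y u = ?rcv y" if "y < x" for y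
    unfolding received_def by (rule receive_cong) (rule less.IH[OF that edge_in_V])
  then have h: "history E s beta_LS X1 \<mu> x u = map ?rcv [0..<x]"
    unfolding history_eq_map by simp
  show ?case
  proof (cases "u = s")
    case True
    then show ?thesis
      unfolding transmitted_def h by (simp add: beta_LS_def initial_def sched_tx_def sched_def)
  next
    case False
    obtain r where r: "?rcv r = Some \<mu>" "\<And>y. y < r \<Longrightarrow> ?rcv y = None"
      "LS_round (X1 u) r = sched E s X1 u"
      using sched_first_reception[OF less.prems False] by metis
    \<comment> \<open>If \<open>x \<le> r\<close>, the minimum is \<open>x\<close>, the test
      \<open>r < length h\<close> of the algorithm fails and the node is silent. The schedule
      agrees, as its round comes after \<open>r\<close>.\<close>
    have "length (takeWhile (\<lambda>y. y = None) (map ?rcv [0..<x])) = min r x"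
      using r by (intro length_takeWhile_map_upt) auto
    moreover have "r < LS_round (X1 u) r" by (simp add: LS_round_def)
    ultimately show ?thesis
      using False r unfolding transmitted_def h
      by (auto simp: beta_LS_def initial_def sched_tx_def Let_def min_def)
  qed
qed

lemma received_beta_LS:
  "received E s beta_LS X1 \<mu> x u = receive E (sched_tx E s X1 \<mu> x) u"
  unfolding received_def by (rule receive_cong) (rule beta_LS_follows_sched[OF edge_in_V])

end

end

theorem theorem2:
  fixes V :: "'v set" and E :: "'v set set" and s :: 'v
    and S1 S2 :: "nat \<Rightarrow> 'v set" and X1 :: "'v \<Rightarrow> bool" and \<mu> :: 'm
  assumes "network V E s"
    and "level_separable V E s"
    and "LS_labelling V E s S1 S2 X1"
  shows "broadcast_by V E s beta_LS X1 \<mu> (2 * ecc V E s)"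
  unfolding broadcast_by_def
proof (intro conjI ballI allI impI)
  fix u assume u: "u \<in> V - {s}"
  then obtain y where "y \<le> 2 * hop_dist E s u - 2" "receive E (sched_tx E s X1 \<mu> y) u = Some \<mu>"
    using sched_reception[OF assms(1,3), of u \<mu>] by auto
  moreover have "hop_dist E s u \<le> ecc V E s"
    using hop_dist_le_ecc[OF assms(1), of u] u by simp
  ultimately show "\<exists>x\<le>2 * ecc V E s. received E s beta_LS X1 \<mu> x u = Some \<mu>"
    unfolding received_beta_LS[OF assms(1,3)] by (intro exI[of _ y]) auto
next
  fix u x assume "u \<in> V" "2 * ecc V E s < x"
  \<comment> \<open>The bound is tight: a node of the last level with a false bit transmits in round
    \<open>2 * ecc V E s\<close> itself.\<close>
  moreover from this have "sched E s X1 u < x"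
    using sched_bounds(1)[OF assms(1) \<open>u \<in> V\<close>, of X1] hop_dist_le_ecc[OF assms(1) \<open>u \<in> V\<close>]
    by linarith
  ultimately show "transmitted E s beta_LS X1 \<mu> x u = None"
    unfolding beta_LS_follows_sched[OF assms(1,3) \<open>u \<in> V\<close>] sched_tx_def by simp
qed

end
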